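(* Let $(M,d)$ be an infinite complete pointed metric space with basepoint $0$. Assume that $M$ has at least two connected components, and that one of them has non-empty interior. Then, for every Lipschitz map $f\colon M\to M$ with $f(0)=0$, the operator $\widehat f\colon \mathcal F(M)\to\mathcal F(M)$ has a non-trivial invariant subspace.
   Context: $\mathbb K$ denotes $\mathbb R$ or $\mathbb C$. For a metric space $M$ with basepoint $0$, $\mathrm{Lip}_0(M)$ is the Banach space of Lipschitz functions $\varphi\colon M\to\mathbb K$ with $\varphi(0)=0$, normed by the best Lipschitz constant. For $x\in M$, $\delta(x)\in \mathrm{Lip}_0(M)^*$ is the evaluation functional $\varphi\mapsto\varphi(x)$. The Lipschitz-free space is $\mathcal F(M):=\overline{\mathrm{span}}\{\delta(x):x\in M\}\subset \mathrm{Lip}_0(M)^*$ (norm closure). For a Lipschitz map $f\colon M\to M$ with $f(0)=0$, $\widehat f\colon\mathcal F(M)\to\mathcal F(M)$ is the unique bounded linear operator with $\widehat f(\delta(x))=\delta(f(x))$ for all $x\in M$. A non-trivial invariant subspace of a bounded operator $T\colon X\to X$ is a closed linear subspace $S$ with $\{0\}\subsetneq S\subsetneq X$ and $T(S)\subset S$. *)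

theory Defs
  imports "HOL-Analysis.Analysis"
begin

text \<open>
  A pointed metric space is a type of class \<open>{metric_space, zero}\<close>. The class \<open>zero\<close> carries no
  axioms, so \<open>0\<close> is an arbitrary distinguished point. The scalars are a type
  \<open>'k\<close> of class \<open>real_normed_field\<close>, to be instantiated with \<open>real\<close> or \<open>complex\<close>. As the library has
  type classes only for real normed spaces, each space below is an instance of
  \<open>real_normed_vector\<close> together with a separate scalar multiplication by \<open>'k\<close>.
\<close>

section \<open>The space of Lipschitz functions vanishing at the basepoint\<close>

typedef (overloaded) ('a::"{metric_space,zero}", 'k::real_normed_field) lip0 =
  "{\<phi> :: 'a \<Rightarrow> 'k. (\<exists>L. L-lipschitz_on UNIV \<phi>) \<and> \<phi> 0 = 0}"
  morphisms lip_fun Abs_lip0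
  by (rule exI[of _ "\<lambda>_. 0"]) (auto intro!: exI[of _ 0] lipschitz_onI)

setup_lifting type_definition_lip0

definition lip_const :: "('a::metric_space \<Rightarrow> 'k::real_normed_field) \<Rightarrow> real" where
  "lip_const \<phi> = Inf {L. L-lipschitz_on UNIV \<phi>}"

lemma lip_const_le: "L-lipschitz_on UNIV \<phi> \<Longrightarrow> lip_const \<phi> \<le> L"
  unfolding lip_const_def
  by (rule cInf_lower) (auto intro!: bdd_belowI[of _ 0] dest: lipschitz_on_nonneg)

lemma lip_const_lipschitz:
  assumes "L-lipschitz_on UNIV \<phi>"
  shows "(lip_const \<phi>)-lipschitz_on UNIV \<phi>"
proof (rule lipschitz_onI)
  have ne: "{L. L-lipschitz_on UNIV \<phi>} \<noteq> {}" using assms by auto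
  show "0 \<le> lip_const \<phi>" unfolding lip_const_def
    by (rule cInf_greatest[OF ne]) (auto dest: lipschitz_on_nonneg)
  fix x y
  show "dist (\<phi> x) (\<phi> y) \<le> lip_const \<phi> * dist x y"
  proof (cases "x = y")
    case False
    then have pos: "dist x y > 0" by simp
    have "dist (\<phi> x) (\<phi> y) / dist x y \<le> lip_const \<phi>" unfolding lip_const_def
      by (rule cInf_greatest[OF ne])
        (use pos in \<open>auto simp: divide_simps dest: lipschitz_onD\<close>)
    then show ?thesis using pos by (simp add: divide_simps)
  qed simp
qed

lemma lipschitz_on_plus_fun:
  fixes \<phi> \<psi> :: "'a::metric_space \<Rightarrow> 'k::real_normed_field"
  assumes "L-lipschitz_on UNIV \<phi>" "K-lipschitz_on UNIV \<psi>"
  shows "(L + K)-lipschitz_on UNIV (\<lambda>x. \<phi> x + \<psi> x)"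
  using assms by (rule lipschitz_on_add)

lemma lipschitz_on_mult_fun:
  fixes \<phi> :: "'a::metric_space \<Rightarrow> 'k::real_normed_field"
  assumes "L-lipschitz_on UNIV \<phi>"
  shows "(norm c * L)-lipschitz_on UNIV (\<lambda>x. c * \<phi> x)"
proof (rule lipschitz_onI)
  show "0 \<le> norm c * L" using lipschitz_on_nonneg[OF assms] by simp
  fix x y
  have "dist (c * \<phi> x) (c * \<phi> y) = norm c * dist (\<phi> x) (\<phi> y)"
    by (simp add: dist_norm norm_mult right_diff_distrib[symmetric])
  also have "\<dots> \<le> norm c * (L * dist x y)"
    by (intro mult_left_mono lipschitz_onD[OF assms]) auto
  finally show "dist (c * \<phi> x) (c * \<phi> y) \<le> norm c * L * dist x y" by (simp add: mult.assoc)
qed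

lift_definition lip_scale ::
  "'k::real_normed_field \<Rightarrow> ('a::{metric_space,zero}, 'k) lip0 \<Rightarrow> ('a, 'k) lip0"
  is "\<lambda>c \<phi> x. c * \<phi> x"
  by (auto intro: lipschitz_on_mult_fun)

instantiation lip0 :: ("{metric_space,zero}", real_normed_field) real_normed_vector
begin

lift_definition zero_lip0 :: "('a, 'b) lip0" is "\<lambda>_. 0"
  by (auto intro!: exI[of _ 0] lipschitz_onI)

lift_definition plus_lip0 :: "('a, 'b) lip0 \<Rightarrow> ('a, 'b) lip0 \<Rightarrow> ('a, 'b) lip0"
  is "\<lambda>\<phi> \<psi> x. \<phi> x + \<psi> x"
  by (auto intro: lipschitz_on_plus_fun)

lift_definition uminus_lip0 :: "('a, 'b) lip0 \<Rightarrow> ('a, 'b) lip0" is "\<lambda>\<phi> x. - \<phi> x"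
  by (auto intro: lipschitz_on_minus)

definition minus_lip0 :: "('a, 'b) lip0 \<Rightarrow> ('a, 'b) lip0 \<Rightarrow> ('a, 'b) lip0"
  where "\<phi> - \<psi> = \<phi> + - (\<psi> :: ('a, 'b) lip0)"

definition scaleR_lip0 :: "real \<Rightarrow> ('a, 'b) lip0 \<Rightarrow> ('a, 'b) lip0"
  where "scaleR_lip0 r = lip_scale (of_real r)"

definition norm_lip0 :: "('a, 'b) lip0 \<Rightarrow> real"
  where "norm_lip0 \<phi> = lip_const (lip_fun \<phi>)"

definition sgn_lip0 :: "('a, 'b) lip0 \<Rightarrow> ('a, 'b) lip0"
  where "sgn_lip0 \<phi> = scaleR (inverse (norm \<phi>)) \<phi>"

definition dist_lip0 :: "('a, 'b) lip0 \<Rightarrow> ('a, 'b) lip0 \<Rightarrow> real"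
  where "dist_lip0 \<phi> \<psi> = norm (\<phi> - \<psi>)"

definition uniformity_lip0 :: "(('a, 'b) lip0 \<times> ('a, 'b) lip0) filter"
  where "uniformity_lip0 = (INF e\<in>{0 <..}. principal {(x, y). dist x y < e})"

definition open_lip0 :: "('a, 'b) lip0 set \<Rightarrow> bool"
  where "open_lip0 U = (\<forall>x\<in>U. \<forall>\<^sub>F (x', y) in uniformity. x' = x \<longrightarrow> y \<in> U)"

instance
proof
  fix \<phi> \<psi> \<theta> :: "('a, 'b) lip0" and r s :: real
  show "\<phi> + \<psi> + \<theta> = \<phi> + (\<psi> + \<theta>)" "\<phi> + \<psi> = \<psi> + \<phi>" "0 + \<phi> = \<phi>" "- \<phi> + \<phi> = 0"
    by (transfer, simp add: algebra_simps)+
  show "\<phi> - \<psi> = \<phi> + - \<psi>" by (simp add: minus_lip0_def)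
  show "r *\<^sub>R (\<phi> + \<psi>) = r *\<^sub>R \<phi> + r *\<^sub>R \<psi>" "(r + s) *\<^sub>R \<phi> = r *\<^sub>R \<phi> + s *\<^sub>R \<phi>"
    "r *\<^sub>R s *\<^sub>R \<phi> = (r * s) *\<^sub>R \<phi>" "1 *\<^sub>R \<phi> = \<phi>"
    unfolding scaleR_lip0_def by (transfer, simp add: algebra_simps)+
  show "dist \<phi> \<psi> = norm (\<phi> - \<psi>)" by (simp add: dist_lip0_def)
  show "sgn \<phi> = scaleR (inverse (norm \<phi>)) \<phi>" by (simp add: sgn_lip0_def)
  show "(uniformity :: (('a, 'b) lip0 \<times> ('a, 'b) lip0) filter)
      = (INF e\<in>{0 <..}. principal {(x, y). dist x y < e})"
    by (simp add: uniformity_lip0_def)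
  show "open U = (\<forall>x\<in>U. \<forall>\<^sub>F (x', y) in uniformity. x' = x \<longrightarrow> y \<in> U)" for U :: "('a, 'b) lip0 set"
    by (simp add: open_lip0_def)
  have lip: "(norm \<theta>)-lipschitz_on UNIV (lip_fun \<theta>)" for \<theta> :: "('a, 'b) lip0"
    unfolding norm_lip0_def using lip_fun[of \<theta>] by (auto intro: lip_const_lipschitz)
  show "norm \<phi> = 0 \<longleftrightarrow> \<phi> = 0"
  proof
    assume "norm \<phi> = 0"
    then have "lip_fun \<phi> x = lip_fun \<phi> 0" for x using lipschitz_onD[OF lip[of \<phi>], of x 0] by simp
    then show "\<phi> = 0" by transfer auto
  next
    assume "\<phi> = 0"
    then have "norm \<phi> \<le> 0" unfolding norm_lip0_def
      by (intro lip_const_le lipschitz_onI) (auto simp: zero_lip0.rep_eq)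
    then show "norm \<phi> = 0" using lipschitz_on_nonneg[OF lip[of \<phi>]] by simp
  qed
  show "norm (\<phi> + \<psi>) \<le> norm \<phi> + norm \<psi>"
    unfolding norm_lip0_def[of "\<phi> + \<psi>"] plus_lip0.rep_eq
    by (intro lip_const_le lipschitz_on_plus_fun lip)
  have le: "norm (c *\<^sub>R \<theta>) \<le> \<bar>c\<bar> * norm \<theta>" for c and \<theta> :: "('a, 'b) lip0"
    unfolding norm_lip0_def[of "c *\<^sub>R \<theta>"] unfolding scaleR_lip0_def lip_scale.rep_eq
    using lipschitz_on_mult_fun[OF lip, of "of_real c :: 'b" \<theta>] by (intro lip_const_le) simp
  show "norm (r *\<^sub>R \<phi>) = \<bar>r\<bar> * norm \<phi>"
  proof (cases "r = 0")
    case True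
    then show ?thesis using le[of r \<phi>] lipschitz_on_nonneg[OF lip[of "r *\<^sub>R \<phi>"]] by simp
  next
    case False
    have "of_real (inverse r) * of_real r = (1 :: 'b)"
      using False by (simp flip: of_real_mult)
    then have "inverse r *\<^sub>R (r *\<^sub>R \<phi>) = \<phi>"
      by (simp add: scaleR_lip0_def lip_fun_inject[symmetric] lip_scale.rep_eq mult.assoc[symmetric]
          del: of_real_inverse)
    then have "norm \<phi> \<le> \<bar>inverse r\<bar> * norm (r *\<^sub>R \<phi>)" using le[of "inverse r" "r *\<^sub>R \<phi>"] by simp
    then show ?thesis using False le[of r \<phi>] by (simp add: field_simps)
  qed
qed

end

lemma lip_fun_lipschitz: "(norm \<phi>)-lipschitz_on UNIV (lip_fun \<phi>)"
  unfolding norm_lip0_def using lip_fun[of \<phi>] by (auto intro: lip_const_lipschitz)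

lemma norm_lip0_le: "L-lipschitz_on UNIV (lip_fun \<phi>) \<Longrightarrow> norm \<phi> \<le> L"
  unfolding norm_lip0_def by (rule lip_const_le)

lemma lip_fun_zero [simp]: "lip_fun \<phi> 0 = 0"
  using lip_fun[of \<phi>] by simp

lemma norm_lip_fun_le: "norm (lip_fun \<phi> x) \<le> norm \<phi> * dist x 0"
  using lipschitz_onD[OF lip_fun_lipschitz[of \<phi>], of x 0] by simp

interpretation lip0: vector_space lip_scale
  by unfold_locales (transfer, simp add: algebra_simps)+

lemma scaleR_lip0_eq: "r *\<^sub>R \<phi> = lip_scale (of_real r) \<phi>"
  by (simp add: scaleR_lip0_def)


section \<open>The dual space\<close>

typedef (overloaded) ('a::"{metric_space,zero}", 'k::real_normed_field) lip0_dual =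
  "{u :: ('a, 'k) lip0 \<Rightarrow> 'k. Vector_Spaces.linear lip_scale (*) u \<and> bounded_linear u}"
  morphisms dual_fun Abs_lip0_dual
proof -
  interpret vector_space_pair lip_scale "(*) :: 'k \<Rightarrow> 'k \<Rightarrow> 'k"
    by unfold_locales (auto simp: algebra_simps)
  show ?thesis by (rule exI[of _ "\<lambda>_. 0"]) (auto intro: linear_0 module_hom_zero linear_zero)
qed

setup_lifting type_definition_lip0_dual

lemma linear_lip0_iff:
  fixes u :: "('a::{metric_space,zero}, 'k::real_normed_field) lip0 \<Rightarrow> 'k"
  shows "Vector_Spaces.linear lip_scale (*) u \<longleftrightarrow>
    (\<forall>\<phi> \<psi>. u (\<phi> + \<psi>) = u \<phi> + u \<psi>) \<and> (\<forall>c \<phi>. u (lip_scale c \<phi>) = c * u \<phi>)"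
proof -
  have "vector_space ((*) :: 'k \<Rightarrow> 'k \<Rightarrow> 'k)" by unfold_locales (auto simp: algebra_simps)
  moreover have "vector_space (lip_scale :: 'k \<Rightarrow> ('a, 'k) lip0 \<Rightarrow> _)"
    by (rule lip0.vector_space_axioms)
  ultimately show ?thesis
    unfolding Vector_Spaces.linear_def module_hom_def module_hom_axioms_def
    by (simp add: module_iff_vector_space)
qed

lift_definition dual_scale ::
  "'k::real_normed_field \<Rightarrow> ('a::{metric_space,zero}, 'k) lip0_dual \<Rightarrow> ('a, 'k) lip0_dual"
  is "\<lambda>c u \<phi>. c * u \<phi>"
  by (auto simp: linear_lip0_iff algebra_simps intro: bounded_linear_const_mult)

instantiation lip0_dual :: ("{metric_space,zero}", real_normed_field) real_normed_vector
begin

lift_definition zero_lip0_dual :: "('a, 'b) lip0_dual" is "\<lambda>_. 0"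
  by (auto simp: linear_lip0_iff)

lift_definition plus_lip0_dual :: "('a, 'b) lip0_dual \<Rightarrow> ('a, 'b) lip0_dual \<Rightarrow> ('a, 'b) lip0_dual"
  is "\<lambda>u v \<phi>. u \<phi> + v \<phi>"
  by (auto simp: linear_lip0_iff algebra_simps intro: bounded_linear_add)

lift_definition uminus_lip0_dual :: "('a, 'b) lip0_dual \<Rightarrow> ('a, 'b) lip0_dual"
  is "\<lambda>u \<phi>. - u \<phi>"
  by (auto simp: linear_lip0_iff algebra_simps intro: bounded_linear_minus)

definition minus_lip0_dual :: "('a, 'b) lip0_dual \<Rightarrow> ('a, 'b) lip0_dual \<Rightarrow> ('a, 'b) lip0_dual"
  where "u - v = u + - (v :: ('a, 'b) lip0_dual)"

definition scaleR_lip0_dual :: "real \<Rightarrow> ('a, 'b) lip0_dual \<Rightarrow> ('a, 'b) lip0_dual"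
  where "scaleR_lip0_dual r = dual_scale (of_real r)"

definition norm_lip0_dual :: "('a, 'b) lip0_dual \<Rightarrow> real"
  where "norm_lip0_dual u = onorm (dual_fun u)"

definition sgn_lip0_dual :: "('a, 'b) lip0_dual \<Rightarrow> ('a, 'b) lip0_dual"
  where "sgn_lip0_dual u = scaleR (inverse (norm u)) u"

definition dist_lip0_dual :: "('a, 'b) lip0_dual \<Rightarrow> ('a, 'b) lip0_dual \<Rightarrow> real"
  where "dist_lip0_dual u v = norm (u - v)"

definition uniformity_lip0_dual :: "(('a, 'b) lip0_dual \<times> ('a, 'b) lip0_dual) filter"
  where "uniformity_lip0_dual = (INF e\<in>{0 <..}. principal {(x, y). dist x y < e})"

definition open_lip0_dual :: "('a, 'b) lip0_dual set \<Rightarrow> bool"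
  where "open_lip0_dual U = (\<forall>x\<in>U. \<forall>\<^sub>F (x', y) in uniformity. x' = x \<longrightarrow> y \<in> U)"

instance
proof
  fix u v w :: "('a, 'b) lip0_dual" and r s :: real
  show "u + v + w = u + (v + w)" "u + v = v + u" "0 + u = u" "- u + u = 0"
    by (transfer, simp add: algebra_simps)+
  show "u - v = u + - v" by (simp add: minus_lip0_dual_def)
  show "r *\<^sub>R (u + v) = r *\<^sub>R u + r *\<^sub>R v" "(r + s) *\<^sub>R u = r *\<^sub>R u + s *\<^sub>R u"
    "r *\<^sub>R s *\<^sub>R u = (r * s) *\<^sub>R u" "1 *\<^sub>R u = u"
    unfolding scaleR_lip0_dual_def by (transfer, simp add: algebra_simps)+
  show "dist u v = norm (u - v)" by (simp add: dist_lip0_dual_def)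
  show "sgn u = scaleR (inverse (norm u)) u" by (simp add: sgn_lip0_dual_def)
  show "(uniformity :: (('a, 'b) lip0_dual \<times> ('a, 'b) lip0_dual) filter)
      = (INF e\<in>{0 <..}. principal {(x, y). dist x y < e})"
    by (simp add: uniformity_lip0_dual_def)
  show "open U = (\<forall>x\<in>U. \<forall>\<^sub>F (x', y) in uniformity. x' = x \<longrightarrow> y \<in> U)" for U :: "('a, 'b) lip0_dual set"
    by (simp add: open_lip0_dual_def)
  have bl: "bounded_linear (dual_fun t)" for t :: "('a, 'b) lip0_dual"
    using dual_fun[of t] by simp
  show "norm u = 0 \<longleftrightarrow> u = 0"
    unfolding norm_lip0_dual_def onorm_eq_0[OF bl] by transfer auto
  show "norm (u + v) \<le> norm u + norm v"
    unfolding norm_lip0_dual_def plus_lip0_dual.rep_eq by (intro onorm_triangle bl)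
  have "dual_fun (r *\<^sub>R u) = (\<lambda>\<phi>. r *\<^sub>R dual_fun u \<phi>)"
    unfolding scaleR_lip0_dual_def dual_scale.rep_eq by (simp add: scaleR_conv_of_real)
  then show "norm (r *\<^sub>R u) = \<bar>r\<bar> * norm u"
    unfolding norm_lip0_dual_def by (simp add: onorm_scaleR[OF bl])
qed

end

interpretation lip0_dual: vector_space dual_scale
  by unfold_locales (transfer, simp add: algebra_simps)+

lift_definition eval_at :: "'a::{metric_space,zero} \<Rightarrow> ('a, 'k::real_normed_field) lip0_dual"
  is "\<lambda>x \<phi>. lip_fun \<phi> x"
proof -
  fix x :: 'a
  have "bounded_linear (\<lambda>\<phi> :: ('a, 'k) lip0. lip_fun \<phi> x)"
    by (rule bounded_linear_intro[where K = "dist x 0"])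
      (simp_all add: plus_lip0.rep_eq scaleR_lip0_eq lip_scale.rep_eq scaleR_conv_of_real
        norm_lip_fun_le)
  then show "Vector_Spaces.linear lip_scale (*) (\<lambda>\<phi> :: ('a, 'k) lip0. lip_fun \<phi> x) \<and>
      bounded_linear (\<lambda>\<phi> :: ('a, 'k) lip0. lip_fun \<phi> x)"
    by (simp add: linear_lip0_iff plus_lip0.rep_eq lip_scale.rep_eq)
qed


section \<open>The Lipschitz-free space\<close>

lemma scaleR_lip0_dual_eq: "r *\<^sub>R u = dual_scale (of_real r) u"
  by (simp add: scaleR_lip0_dual_def)

lemma norm_dual_scale: "norm (dual_scale c u) = norm c * norm u"
proof -
  have bl: "bounded_linear (dual_fun t)" for t :: "('a, 'b) lip0_dual"
    using dual_fun[of t] by simp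
  have le: "norm (dual_scale c u) \<le> norm c * norm u" for c and u :: "('a, 'b) lip0_dual"
    unfolding norm_lip0_dual_def
  proof (rule onorm_bound)
    show "norm (dual_fun (dual_scale c u) \<phi>) \<le> norm c * onorm (dual_fun u) * norm \<phi>" for \<phi>
      using onorm[OF bl[of u], of \<phi>] by (simp add: dual_scale.rep_eq norm_mult mult.assoc mult_left_mono)
  qed (simp add: onorm_pos_le[OF bl])
  show ?thesis
  proof (cases "c = 0")
    case True
    then show ?thesis by simp
  next
    case False
    then have "norm u \<le> norm (inverse c) * norm (dual_scale c u)"
      using le[of "inverse c" "dual_scale c u"] by simp
    then have "norm c * norm u \<le> norm (dual_scale c u)"
      using False by (simp add: norm_divide field_simps)
    then show ?thesis using le[of c u] by simp
  qed
qed

lemma subspace_closure_dual: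
  fixes A :: "('a::{metric_space,zero}, 'k::real_normed_field) lip0_dual set"
  assumes "lip0_dual.subspace A"
  shows "lip0_dual.subspace (closure A)"
proof (rule lip0_dual.subspaceI)
  show "0 \<in> closure A"
    using lip0_dual.subspace_0[OF assms] closure_subset by blast
next
  fix x y assume "x \<in> closure A" "y \<in> closure A"
  then obtain f g where "\<And>n. f n \<in> A" "f \<longlonglongrightarrow> x" "\<And>n. g n \<in> A" "g \<longlonglongrightarrow> y"
    unfolding closure_sequential by blast
  then have "\<And>n. f n + g n \<in> A" "(\<lambda>n. f n + g n) \<longlonglongrightarrow> x + y"
    using lip0_dual.subspace_add[OF assms] by (auto intro: tendsto_add)
  then show "x + y \<in> closure A" unfolding closure_sequential
    by (intro exI[of _ "\<lambda>n. f n + g n"]) auto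
next
  fix c :: 'k and x assume "x \<in> closure A"
  then obtain f where f: "\<And>n. f n \<in> A" "f \<longlonglongrightarrow> x"
    unfolding closure_sequential by blast
  have "bounded_linear (dual_scale c)"
    by (rule bounded_linear_intro[where K = "norm c"])
      (simp_all add: lip0_dual.scale_right_distrib scaleR_lip0_dual_eq norm_dual_scale mult.commute)
  then have "(\<lambda>n. dual_scale c (f n)) \<longlonglongrightarrow> dual_scale c x"
    using f(2) by (rule bounded_linear.tendsto)
  then show "dual_scale c x \<in> closure A"
    using lip0_dual.subspace_scale[OF assms f(1)] unfolding closure_sequential
    by (intro exI[of _ "\<lambda>n. dual_scale c (f n)"]) auto
qed

typedef (overloaded) ('a::"{metric_space,zero}", 'k::real_normed_field) lip_free =
  "closure (module.span dual_scale (range (eval_at :: 'a \<Rightarrow> ('a, 'k) lip0_dual)))"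
  morphisms free_functional Abs_lip_free
  using lip0_dual.span_zero closure_subset by blast

setup_lifting type_definition_lip_free

lemma subspace_lip_free:
  "lip0_dual.subspace (closure (lip0_dual.span (range (eval_at :: 'a::{metric_space,zero} \<Rightarrow> ('a, 'k::real_normed_field) lip0_dual))))"
  by (intro subspace_closure_dual lip0_dual.subspace_span)

lift_definition free_scale ::
  "'k::real_normed_field \<Rightarrow> ('a::{metric_space,zero}, 'k) lip_free \<Rightarrow> ('a, 'k) lip_free"
  is dual_scale
  by (rule lip0_dual.subspace_scale[OF subspace_lip_free])

instantiation lip_free :: ("{metric_space,zero}", real_normed_field) real_normed_vector
begin

lift_definition zero_lip_free :: "('a, 'b) lip_free" is 0
  by (rule lip0_dual.subspace_0[OF subspace_lip_free])

lift_definition plus_lip_free :: "('a, 'b) lip_free \<Rightarrow> ('a, 'b) lip_free \<Rightarrow> ('a, 'b) lip_free"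
  is "(+)"
  by (rule lip0_dual.subspace_add[OF subspace_lip_free])

lift_definition uminus_lip_free :: "('a, 'b) lip_free \<Rightarrow> ('a, 'b) lip_free" is uminus
  by (rule lip0_dual.subspace_neg[OF subspace_lip_free])

lift_definition minus_lip_free :: "('a, 'b) lip_free \<Rightarrow> ('a, 'b) lip_free \<Rightarrow> ('a, 'b) lip_free"
  is "(-)"
  by (rule lip0_dual.subspace_diff[OF subspace_lip_free])

lift_definition scaleR_lip_free :: "real \<Rightarrow> ('a, 'b) lip_free \<Rightarrow> ('a, 'b) lip_free" is scaleR
  unfolding scaleR_lip0_dual_eq by (rule lip0_dual.subspace_scale[OF subspace_lip_free])

lift_definition norm_lip_free :: "('a, 'b) lip_free \<Rightarrow> real" is norm .

definition sgn_lip_free :: "('a, 'b) lip_free \<Rightarrow> ('a, 'b) lip_free"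
  where "sgn_lip_free u = scaleR (inverse (norm u)) u"

definition dist_lip_free :: "('a, 'b) lip_free \<Rightarrow> ('a, 'b) lip_free \<Rightarrow> real"
  where "dist_lip_free u v = norm (u - v)"

definition uniformity_lip_free :: "(('a, 'b) lip_free \<times> ('a, 'b) lip_free) filter"
  where "uniformity_lip_free = (INF e\<in>{0 <..}. principal {(x, y). dist x y < e})"

definition open_lip_free :: "('a, 'b) lip_free set \<Rightarrow> bool"
  where "open_lip_free U = (\<forall>x\<in>U. \<forall>\<^sub>F (x', y) in uniformity. x' = x \<longrightarrow> y \<in> U)"

instance
proof
  fix u v w :: "('a, 'b) lip_free" and r s :: real
  show "u + v + w = u + (v + w)" "u + v = v + u" "0 + u = u" "- u + u = 0" "u - v = u + - v"
    by (simp_all add: free_functional_inject[symmetric] plus_lip_free.rep_eq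
        zero_lip_free.rep_eq uminus_lip_free.rep_eq minus_lip_free.rep_eq ac_simps)
  show "r *\<^sub>R (u + v) = r *\<^sub>R u + r *\<^sub>R v" "(r + s) *\<^sub>R u = r *\<^sub>R u + s *\<^sub>R u"
    "r *\<^sub>R s *\<^sub>R u = (r * s) *\<^sub>R u" "1 *\<^sub>R u = u"
    by (simp_all add: free_functional_inject[symmetric] plus_lip_free.rep_eq
        scaleR_lip_free.rep_eq scaleR_add_left scaleR_add_right)
  show "dist u v = norm (u - v)" by (simp add: dist_lip_free_def)
  show "sgn u = scaleR (inverse (norm u)) u" by (simp add: sgn_lip_free_def)
  show "(uniformity :: (('a, 'b) lip_free \<times> ('a, 'b) lip_free) filter)
      = (INF e\<in>{0 <..}. principal {(x, y). dist x y < e})"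
    by (simp add: uniformity_lip_free_def)
  show "open U = (\<forall>x\<in>U. \<forall>\<^sub>F (x', y) in uniformity. x' = x \<longrightarrow> y \<in> U)" for U :: "('a, 'b) lip_free set"
    by (simp add: open_lip_free_def)
  show "norm u = 0 \<longleftrightarrow> u = 0"
    by (simp add: norm_lip_free.rep_eq free_functional_inject[symmetric] zero_lip_free.rep_eq)
  show "norm (u + v) \<le> norm u + norm v"
    by (simp add: norm_lip_free.rep_eq plus_lip_free.rep_eq norm_triangle_ineq)
  show "norm (r *\<^sub>R u) = \<bar>r\<bar> * norm u"
    by (simp add: norm_lip_free.rep_eq scaleR_lip_free.rep_eq)
qed

end

interpretation lip_free: vector_space free_scale
  by unfold_locales
    (simp_all add: free_functional_inject[symmetric] plus_lip_free.rep_eq free_scale.rep_eq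
      lip0_dual.scale_left_distrib lip0_dual.scale_right_distrib)

lift_definition free_delta :: "'a::{metric_space,zero} \<Rightarrow> ('a, 'k::real_normed_field) lip_free" is eval_at
  by (rule subsetD[OF closure_subset], rule lip0_dual.span_base) simp


section \<open>Linearization of a Lipschitz map and invariant subspaces\<close>

text \<open>
  The description operator in \<open>free_map\<close> is meaningful for Lipschitz \<open>f\<close> with \<open>f 0 = 0\<close>: see
  \<open>linearizes_exists\<close>, \<open>linearizes_unique\<close> and \<open>free_map_linearizes\<close>.
\<close>

definition linearizes ::
  "('a::{metric_space,zero} \<Rightarrow> 'a) \<Rightarrow> (('a, 'k::real_normed_field) lip_free \<Rightarrow> ('a, 'k) lip_free) \<Rightarrow> bool" where
  "linearizes f T \<longleftrightarrow> Vector_Spaces.linear free_scale free_scale T \<and> bounded_linear T \<and>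
     (\<forall>x. T (free_delta x) = free_delta (f x))"

definition free_map ::
  "('a::{metric_space,zero} \<Rightarrow> 'a) \<Rightarrow> ('a, 'k::real_normed_field) lip_free \<Rightarrow> ('a, 'k) lip_free" where
  "free_map f = (THE T. linearizes f T)"

lemma linear_lip_free_iff:
  fixes T :: "('a::{metric_space,zero}, 'k::real_normed_field) lip_free \<Rightarrow> ('a, 'k) lip_free"
  shows "Vector_Spaces.linear free_scale free_scale T \<longleftrightarrow>
    (\<forall>u v. T (u + v) = T u + T v) \<and> (\<forall>c u. T (free_scale c u) = free_scale c (T u))"
proof -
  have "vector_space (free_scale :: 'k \<Rightarrow> ('a, 'k) lip_free \<Rightarrow> _)"
    by (rule lip_free.vector_space_axioms)
  then show ?thesis
    unfolding Vector_Spaces.linear_def module_hom_def module_hom_axioms_def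
    by (simp add: module_iff_vector_space)
qed

lemma scaleR_lip_free_eq: "r *\<^sub>R u = free_scale (of_real r) u"
  by (simp add: free_functional_inject[symmetric] scaleR_lip_free.rep_eq free_scale.rep_eq
      scaleR_lip0_dual_eq)

lemma bounded_linear_dual_fun: "bounded_linear (dual_fun u)"
  using dual_fun[of u] by simp

lemma linearizes_unique:
  assumes "linearizes f T" "linearizes f T'"
  shows "T = T'"
proof
  fix w :: "('a, 'b) lip_free"
  let ?sp = "lip0_dual.span (range (eval_at :: 'a \<Rightarrow> ('a, 'b) lip0_dual))"
  have T: "\<And>u v. T (u + v) = T u + T v" "\<And>c u. T (free_scale c u) = free_scale c (T u)"
    "\<And>u v. T' (u + v) = T' u + T' v" "\<And>c u. T' (free_scale c u) = free_scale c (T' u)"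
    "\<And>x. T (free_delta x) = T' (free_delta x)" "bounded_linear T" "bounded_linear T'"
    using assms by (auto simp: linearizes_def linear_lip_free_iff)
  have span: "\<exists>v. free_functional v = a \<and> T v = T' v" if "a \<in> ?sp" for a
    using that
  proof (induction rule: lip0_dual.span_induct_alt)
    case base
    show ?case
      using T(6,7) by (intro exI[of _ 0]) (simp add: zero_lip_free.rep_eq linear_simps)
  next
    case (step c x y)
    then obtain v z where "free_functional v = y" "T v = T' v" "x = eval_at z" by auto
    then show ?case
      by (intro exI[of _ "free_scale c (free_delta z) + v"])
        (simp add: T plus_lip_free.rep_eq free_scale.rep_eq free_delta.rep_eq)
  qed
  have "free_functional w \<in> closure ?sp" using free_functional by blast
  then obtain a where a: "\<And>n. a n \<in> ?sp" "a \<longlonglongrightarrow> free_functional w"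
    unfolding closure_sequential by blast
  obtain v where v: "\<And>n. free_functional (v n) = a n" "\<And>n. T (v n) = T' (v n)"
    using span[OF a(1)] by metis
  have "norm (v n - w) = norm (a n - free_functional w)" for n
    by (simp add: norm_lip_free.rep_eq minus_lip_free.rep_eq v)
  then have "v \<longlonglongrightarrow> w" using a(2) by (simp add: tendsto_iff dist_norm)
  then have "(\<lambda>n. T (v n)) \<longlonglongrightarrow> T w" "(\<lambda>n. T' (v n)) \<longlonglongrightarrow> T' w"
    using T(6,7) bounded_linear.tendsto by blast+
  then show "T w = T' w" using v(2) LIMSEQ_unique by simp
qed

lemma linearizes_exists:
  fixes f :: "'a::{metric_space,zero} \<Rightarrow> 'a"
  assumes f: "L-lipschitz_on UNIV f" "f 0 = 0"
  shows "\<exists>T :: ('a, 'k::real_normed_field) lip_free \<Rightarrow> ('a, 'k) lip_free. linearizes f T"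
proof -
  have L: "0 \<le> L" using f(1) by (rule lipschitz_on_nonneg)
  have comp: "(norm \<phi> * L)-lipschitz_on UNIV (\<lambda>x. lip_fun \<phi> (f x))" for \<phi> :: "('a, 'k) lip0"
    using lipschitz_on_compose2[OF f(1) lipschitz_on_subset[OF lip_fun_lipschitz]] by blast
  define P :: "('a, 'k) lip0 \<Rightarrow> ('a, 'k) lip0" where "P \<phi> = Abs_lip0 (\<lambda>x. lip_fun \<phi> (f x))" for \<phi>
  have P: "lip_fun (P \<phi>) = (\<lambda>x. lip_fun \<phi> (f x))" for \<phi>
    unfolding P_def using comp f(2) by (subst Abs_lip0_inverse) auto
  have P_add: "P (\<phi> + \<psi>) = P \<phi> + P \<psi>" and P_scale: "P (lip_scale c \<phi>) = lip_scale c (P \<phi>)" for \<phi> \<psi> c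
    by (simp_all add: lip_fun_inject[symmetric] P plus_lip0.rep_eq lip_scale.rep_eq)
  have P_norm: "norm (P \<phi>) \<le> norm \<phi> * L" for \<phi>
    using comp by (intro norm_lip0_le) (simp add: P)
  have P_bl: "bounded_linear P"
    by (rule bounded_linear_intro[where K = L]) (simp_all add: P_add scaleR_lip0_eq P_scale P_norm)
  define D :: "('a, 'k) lip0_dual \<Rightarrow> ('a, 'k) lip0_dual"
    where "D u = Abs_lip0_dual (\<lambda>\<phi>. dual_fun u (P \<phi>))" for u
  have D: "dual_fun (D u) = (\<lambda>\<phi>. dual_fun u (P \<phi>))" for u
    unfolding D_def using dual_fun[of u]
    by (subst Abs_lip0_dual_inverse)
      (auto simp: linear_lip0_iff P_add P_scale intro: bounded_linear_compose[OF _ P_bl])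
  have D_add: "D (u + v) = D u + D v" and D_scale: "D (dual_scale c u) = dual_scale c (D u)" for u v c
    by (simp_all add: dual_fun_inject[symmetric] D plus_lip0_dual.rep_eq dual_scale.rep_eq)
  have D_eval: "D (eval_at x) = eval_at (f x)" for x
    by (simp add: dual_fun_inject[symmetric] D eval_at.rep_eq P)
  have D_norm: "norm (D u) \<le> norm u * L" for u
    unfolding norm_lip0_dual_def
  proof (rule onorm_bound)
    fix \<phi>
    have "norm (dual_fun (D u) \<phi>) \<le> onorm (dual_fun u) * norm (P \<phi>)"
      unfolding D by (rule onorm[OF bounded_linear_dual_fun])
    also have "\<dots> \<le> onorm (dual_fun u) * (norm \<phi> * L)"
      by (intro mult_left_mono P_norm onorm_pos_le bounded_linear_dual_fun)
    finally show "norm (dual_fun (D u) \<phi>) \<le> onorm (dual_fun u) * L * norm \<phi>"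
      by (simp add: mult_ac)
  qed (simp add: L onorm_pos_le bounded_linear_dual_fun)
  have D_bl: "bounded_linear D"
    by (rule bounded_linear_intro[where K = L])
      (simp_all add: D_add scaleR_lip0_dual_eq D_scale D_norm)
  let ?sp = "lip0_dual.span (range (eval_at :: 'a \<Rightarrow> ('a, 'k) lip0_dual))"
  have D_span: "D a \<in> ?sp" if "a \<in> ?sp" for a
    using that
  proof (induction rule: lip0_dual.span_induct_alt)
    case base
    show ?case using D_bl lip0_dual.span_zero by (simp add: linear_simps)
  next
    case (step c x y)
    then obtain z where "x = eval_at z" by blast
    moreover have "dual_scale c (eval_at (f z)) \<in> ?sp"
      by (intro lip0_dual.span_scale lip0_dual.span_base) simp
    ultimately show ?case
      using step.IH by (simp add: D_add D_scale D_eval lip0_dual.span_add)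
  qed
  have D_closure: "D a \<in> closure ?sp" if a: "a \<in> closure ?sp" for a
  proof -
    obtain b where b: "\<And>n. b n \<in> ?sp" "b \<longlonglongrightarrow> a" using a unfolding closure_sequential by blast
    show ?thesis unfolding closure_sequential
      using D_span[OF b(1)] bounded_linear.tendsto[OF D_bl b(2)]
      by (intro exI[of _ "\<lambda>n. D (b n)"]) auto
  qed
  define T :: "('a, 'k) lip_free \<Rightarrow> ('a, 'k) lip_free"
    where "T u = Abs_lip_free (D (free_functional u))" for u
  have T: "free_functional (T u) = D (free_functional u)" for u
    unfolding T_def by (rule Abs_lip_free_inverse[OF D_closure[OF free_functional]])
  have T_add: "T (u + v) = T u + T v" and T_scale: "T (free_scale c u) = free_scale c (T u)" for u v c
    by (simp_all add: free_functional_inject[symmetric] T plus_lip_free.rep_eq free_scale.rep_eq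
        D_add D_scale)
  have "bounded_linear T"
    by (rule bounded_linear_intro[where K = L])
      (simp_all add: T_add scaleR_lip_free_eq T_scale norm_lip_free.rep_eq T D_norm)
  moreover have "T (free_delta x) = free_delta (f x)" for x
    by (simp add: free_functional_inject[symmetric] T free_delta.rep_eq D_eval)
  ultimately show ?thesis
    by (intro exI[of _ T]) (simp add: linearizes_def linear_lip_free_iff T_add T_scale)
qed

lemma free_map_linearizes:
  assumes "L-lipschitz_on UNIV f" "f 0 = 0"
  shows "linearizes f (free_map f)"
proof -
  obtain T :: "('a, 'b) lip_free \<Rightarrow> ('a, 'b) lip_free" where T: "linearizes f T"
    using linearizes_exists[OF assms] by blast
  show ?thesis
    unfolding free_map_def
    by (rule theI[where P = "linearizes f", OF T]) (rule linearizes_unique[OF _ T])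
qed

definition nontrivial_invariant_subspace ::
  "('k::field \<Rightarrow> 'v::real_normed_vector \<Rightarrow> 'v) \<Rightarrow> ('v \<Rightarrow> 'v) \<Rightarrow> 'v set \<Rightarrow> bool" where
  "nontrivial_invariant_subspace sc T S \<longleftrightarrow>
     module.subspace sc S \<and> closed S \<and> {0} \<subset> S \<and> S \<subset> UNIV \<and> T ` S \<subseteq> S"

end

theory Submission
  imports Defs
begin

text \<open>
  A family \<open>\<Phi>\<close> of Lipschitz functions closed under \<open>\<phi> \<mapsto> \<phi> \<circ> f\<close> has an invariant annihilator.
  Applied to the functions vanishing on a closed set \<open>A \<ni> 0\<close> with \<open>f(A) \<subseteq> A\<close>, this settles the
  case where such an \<open>A\<close> exists with \<open>{0} \<noteq> A \<noteq> M\<close>. Applied to the indicator function of \<open>M - {0}\<close>,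
  it settles the case where \<open>0\<close> is isolated (if \<open>f(x) = 0\<close> with \<open>x \<noteq> 0\<close>, take \<open>A = {0, x}\<close> instead).

  In the remaining case the component of \<open>0\<close> is closed, invariant and proper, so that it may be
  assumed to be \<open>{0}\<close>. The component \<open>C\<close> with interior then does not contain \<open>0\<close>. Take \<open>x\<close> in the
  interior. If the closed invariant set generated by \<open>f(x)\<close> is all of \<open>M\<close>, the orbit of \<open>x\<close> returns
  to \<open>C\<close>, so finitely many components form a closed invariant set \<open>B\<close> missing \<open>0\<close>. Either
  \<open>B \<union> {0}\<close> is proper, or \<open>B = M - {0}\<close> and \<open>0\<close> is isolated.
\<close>

section \<open>Pairing of the free space with Lipschitz functions\<close>

definition free_pairing :: "('a::{metric_space,zero}, 'k::real_normed_field) lip_free \<Rightarrow> ('a, 'k) lip0 \<Rightarrow> 'k"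
  where "free_pairing u = dual_fun (free_functional u)"

lemma free_pairing_delta [simp]: "free_pairing (free_delta x) \<phi> = lip_fun \<phi> x"
  by (simp add: free_pairing_def free_delta.rep_eq eval_at.rep_eq)

lemma free_pairing_zero [simp]: "free_pairing 0 \<phi> = 0"
  by (simp add: free_pairing_def zero_lip_free.rep_eq zero_lip0_dual.rep_eq)

lemma free_pairing_add [simp]: "free_pairing (u + v) \<phi> = free_pairing u \<phi> + free_pairing v \<phi>"
  by (simp add: free_pairing_def plus_lip_free.rep_eq plus_lip0_dual.rep_eq)

lemma free_pairing_scale [simp]: "free_pairing (free_scale c u) \<phi> = c * free_pairing u \<phi>"
  by (simp add: free_pairing_def free_scale.rep_eq dual_scale.rep_eq)

lemma norm_free_pairing_le: "norm (free_pairing u \<phi>) \<le> norm u * norm \<phi>"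
  unfolding free_pairing_def norm_lip_free.rep_eq norm_lip0_dual_def
  by (rule onorm[OF bounded_linear_dual_fun])

lemma bounded_linear_free_pairing: "bounded_linear (\<lambda>u. free_pairing u \<phi>)"
  by (rule bounded_linear_intro[where K = "norm \<phi>"])
    (simp_all add: scaleR_lip_free_eq scaleR_conv_of_real norm_free_pairing_le)

lemma free_pairing_diff [simp]: "free_pairing (u - v) \<phi> = free_pairing u \<phi> - free_pairing v \<phi>"
  using bounded_linear_free_pairing by (rule linear_simps(2))

text \<open>The span of the evaluation functionals is dense, so a closed property that survives
  adding multiples of deltas holds everywhere.\<close>

lemma lip_free_induct [consumes 1, case_names zero add]:
  fixes u :: "('a::{metric_space,zero}, 'k::real_normed_field) lip_free"
  assumes "closed {u. P u}" and "P 0"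
    and add: "\<And>c x u. P u \<Longrightarrow> P (free_scale c (free_delta x) + u)"
  shows "P u"
proof -
  let ?sp = "lip0_dual.span (range (eval_at :: 'a \<Rightarrow> ('a, 'k) lip0_dual))"
  have span: "\<exists>v. free_functional v = a \<and> P v" if "a \<in> ?sp" for a
    using that
  proof (induction rule: lip0_dual.span_induct_alt)
    case base
    show ?case
      using \<open>P 0\<close> by (intro exI[of _ 0]) (simp add: zero_lip_free.rep_eq)
  next
    case (step c x y)
    then obtain v z where "free_functional v = y" "P v" "x = eval_at z" by auto
    then show ?case
      by (intro exI[of _ "free_scale c (free_delta z) + v"])
        (simp add: add plus_lip_free.rep_eq free_scale.rep_eq free_delta.rep_eq)
  qed
  have "free_functional u \<in> closure ?sp" using free_functional by blast
  then obtain a where a: "\<And>n. a n \<in> ?sp" "a \<longlonglongrightarrow> free_functional u"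
    unfolding closure_sequential by blast
  obtain v where v: "\<And>n. free_functional (v n) = a n" "\<And>n. P (v n)"
    using span[OF a(1)] by metis
  have "norm (v n - u) = norm (a n - free_functional u)" for n
    by (simp add: norm_lip_free.rep_eq minus_lip_free.rep_eq v)
  then have "v \<longlonglongrightarrow> u" using a(2) by (simp add: tendsto_iff dist_norm)
  then show ?thesis
    using closed_sequentially[OF assms(1), of v u] v(2) by simp
qed

text \<open>Duality: \<open>free_map f\<close> is the preadjoint of composition with
  \<open>f\<close>. Both sides are continuous and linear in \<open>u\<close> and agree on
  deltas.\<close>

lemma free_pairing_free_map:
  fixes \<phi> \<psi> :: "('a::{metric_space,zero}, 'k::real_normed_field) lip0"
  assumes f: "L-lipschitz_on UNIV f" "f 0 = 0"
    and \<psi>: "\<And>x. lip_fun \<psi> x = lip_fun \<phi> (f x)"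
  shows "free_pairing (free_map f u) \<phi> = free_pairing u \<psi>"
proof -
  let ?T = "free_map f :: ('a, 'k) lip_free \<Rightarrow> ('a, 'k) lip_free"
  have T: "?T (u + v) = ?T u + ?T v" "?T (free_scale c u) = free_scale c (?T u)"
    "?T (free_delta x) = free_delta (f x)" "bounded_linear ?T" for u v c x
    using free_map_linearizes[OF f, where ?'b = 'k] by (auto simp: linearizes_def linear_lip_free_iff)
  have "closed {u. free_pairing (?T u) \<phi> = free_pairing u \<psi>}"
    by (rule closed_Collect_eq[OF
          linear_continuous_on[OF bounded_linear_compose[OF bounded_linear_free_pairing T(4)]]
          linear_continuous_on[OF bounded_linear_free_pairing]])
  then show ?thesis
  proof (induction u rule: lip_free_induct)
    case zero
    show ?case using T(4) by (simp add: linear_simps)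
  next
    case (add c x u)
    then show ?case by (simp add: T \<psi>)
  qed
qed

section \<open>Invariant subspaces as annihilators\<close>

text \<open>The annihilator is an intersection of kernels of bounded functionals, hence closed. The
  witness \<open>u\<close> makes it nonzero, \<open>free_delta x\<close> lies outside it, and
  \<open>comp\<close> gives invariance by duality.\<close>

lemma invariant_annihilator:
  fixes \<Phi> :: "('a::{metric_space,zero}, 'k::real_normed_field) lip0 set"
  assumes f: "L-lipschitz_on UNIV f" "f 0 = 0"
    and comp: "\<And>\<phi>. \<phi> \<in> \<Phi> \<Longrightarrow> \<exists>\<psi>\<in>\<Phi>. \<forall>x. lip_fun \<psi> x = lip_fun \<phi> (f x)"
    and "\<phi> \<in> \<Phi>" "lip_fun \<phi> x \<noteq> 0"
    and "u \<noteq> 0" "\<And>\<phi>. \<phi> \<in> \<Phi> \<Longrightarrow> free_pairing u \<phi> = 0"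
  shows "nontrivial_invariant_subspace free_scale (free_map f) {u. \<forall>\<phi>\<in>\<Phi>. free_pairing u \<phi> = 0}"
    (is "nontrivial_invariant_subspace _ _ ?S")
  unfolding nontrivial_invariant_subspace_def
proof (intro conjI)
  show "lip_free.subspace ?S"
    by (rule lip_free.subspaceI) auto
  have "?S = (\<Inter>\<phi>\<in>\<Phi>. {u. free_pairing u \<phi> = 0})" by auto
  moreover have "closed {u. free_pairing u \<phi> = 0}" for \<phi> :: "('a, 'k) lip0"
    by (intro closed_Collect_eq linear_continuous_on bounded_linear_free_pairing continuous_on_const)
  ultimately show "closed ?S" by auto
  show "{0} \<subset> ?S" using assms(6,7) by auto
  have "free_delta x \<notin> ?S" using assms(4,5) by auto
  then show "?S \<subset> UNIV" by blast
  show "free_map f ` ?S \<subseteq> ?S"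
  proof clarify
    fix v \<phi> assume "\<forall>\<phi>\<in>\<Phi>. free_pairing v \<phi> = 0" "\<phi> \<in> \<Phi>"
    then show "free_pairing (free_map f v) \<phi> = 0"
      using comp[of \<phi>] free_pairing_free_map[OF f, where ?'k = 'k] by metis
  qed
qed

lemma lip0_of_lipschitz:
  fixes g :: "'a::{metric_space,zero} \<Rightarrow> 'k::real_normed_field"
  assumes "L-lipschitz_on UNIV g" "g 0 = 0"
  obtains \<phi> :: "('a, 'k) lip0" where "lip_fun \<phi> = g"
  using assms Abs_lip0_inverse[of g] by blast

text \<open>The distance to \<open>A\<close> is 1-Lipschitz and vanishes exactly on the closed set
  \<open>A\<close>.\<close>

lemma lip0_separates:
  fixes A :: "'a::{metric_space,zero} set"
  assumes "closed A" "0 \<in> A" "x \<notin> A"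
  obtains \<phi> :: "('a, 'k::real_normed_field) lip0"
  where "\<And>a. a \<in> A \<Longrightarrow> lip_fun \<phi> a = 0" "lip_fun \<phi> x \<noteq> 0"
proof -
  have "1-lipschitz_on UNIV (\<lambda>x. of_real (infdist x A) :: 'k)"
  proof (rule lipschitz_onI)
    fix x y
    show "dist (of_real (infdist x A) :: 'k) (of_real (infdist y A)) \<le> 1 * dist x y"
      using infdist_triangle_abs[of x A y] by (simp add: dist_norm flip: of_real_diff)
  qed simp
  then obtain \<phi> :: "('a, 'k) lip0" where "lip_fun \<phi> = (\<lambda>x. of_real (infdist x A))"
    using \<open>0 \<in> A\<close> by (auto elim: lip0_of_lipschitz)
  moreover have "infdist x A \<noteq> 0"
    using assms in_closed_iff_infdist_zero by blast
  ultimately show ?thesis by (intro that[of \<phi>]) auto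
qed

lemma free_delta_eq_iff:
  fixes x y :: "'a::{metric_space,zero}"
  shows "(free_delta x :: ('a, 'k::real_normed_field) lip_free) = free_delta y \<longleftrightarrow> x = y"
proof -
  \<comment> \<open>Of two distinct points at least one is nonzero; by symmetry it may be called
    \<open>x\<close>.\<close>
  have "free_delta x \<noteq> (free_delta y :: ('a, 'k) lip_free)" if x: "x \<notin> {0, y}" for x y :: 'a
  proof -
    obtain \<phi> :: "('a, 'k) lip0" where "\<And>a. a \<in> {0, y} \<Longrightarrow> lip_fun \<phi> a = 0" "lip_fun \<phi> x \<noteq> 0"
      by (rule lip0_separates[of "{0, y}" x]) (use x in auto)
    then show ?thesis by (metis free_pairing_delta insertCI)
  qed
  then show ?thesis by (metis insertE empty_iff)
qed

lemma free_delta_eq_0_iff: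
  fixes x :: "'a::{metric_space,zero}"
  shows "(free_delta x :: ('a, 'k::real_normed_field) lip_free) = 0 \<longleftrightarrow> x = 0"
proof -
  have "(free_delta 0 :: ('a, 'k) lip_free) = 0"
    by (simp add: free_functional_inject[symmetric] dual_fun_inject[symmetric] free_delta.rep_eq
        zero_lip_free.rep_eq eval_at.rep_eq zero_lip0_dual.rep_eq)
  then show ?thesis by (metis free_delta_eq_iff)
qed

lemma invariant_subspace_of_invariant_set:
  fixes f :: "'a::{metric_space,zero} \<Rightarrow> 'a"
  assumes f: "L-lipschitz_on UNIV f" "f 0 = 0"
    and A: "closed A" "0 \<in> A" "f ` A \<subseteq> A" "A \<noteq> {0}" "A \<noteq> UNIV"
  shows "\<exists>S. nontrivial_invariant_subspace free_scale
    (free_map f :: ('a, 'k::real_normed_field) lip_free \<Rightarrow> _) S"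
proof -
  obtain x where "x \<notin> A" using A(5) by auto
  then obtain \<phi> :: "('a, 'k) lip0" where \<phi>: "\<And>a. a \<in> A \<Longrightarrow> lip_fun \<phi> a = 0" "lip_fun \<phi> x \<noteq> 0"
    using lip0_separates A by metis
  obtain a where a: "a \<in> A" "a \<noteq> 0" using A by blast
  define \<Phi> :: "('a, 'k) lip0 set" where "\<Phi> = {\<phi>. \<forall>a\<in>A. lip_fun \<phi> a = 0}"
  have "\<exists>\<psi>\<in>\<Phi>. \<forall>x. lip_fun \<psi> x = lip_fun \<phi> (f x)" if "\<phi> \<in> \<Phi>" for \<phi>
  proof -
    have "(norm \<phi> * L)-lipschitz_on UNIV (\<lambda>x. lip_fun \<phi> (f x))"
      using lipschitz_on_compose2[OF f(1) lipschitz_on_subset[OF lip_fun_lipschitz]] by blast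
    then obtain \<psi> :: "('a, 'k) lip0" where "lip_fun \<psi> = (\<lambda>x. lip_fun \<phi> (f x))"
      using f(2) by (auto elim: lip0_of_lipschitz)
    then show ?thesis using that A(3) by (intro bexI[of _ \<psi>]) (auto simp: \<Phi>_def)
  qed
  moreover have "\<phi> \<in> \<Phi>" using \<phi>(1) by (simp add: \<Phi>_def)
  moreover have "free_pairing (free_delta a) \<phi> = 0" if "\<phi> \<in> \<Phi>" for \<phi>
    using that a(1) by (simp add: \<Phi>_def)
  ultimately show ?thesis
    using invariant_annihilator[OF f, of \<Phi> \<phi> x "free_delta a"] \<phi>(2) a(2)
    by (auto simp: free_delta_eq_0_iff)
qed

lemma invariant_subspace_of_isolated_basepoint:
  fixes f :: "'a::{metric_space,zero} \<Rightarrow> 'a"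
  assumes inf: "infinite (UNIV :: 'a set)"
    and f: "L-lipschitz_on UNIV f" "f 0 = 0"
    and "open {0 :: 'a}"
  shows "\<exists>S. nontrivial_invariant_subspace free_scale
    (free_map f :: ('a, 'k::real_normed_field) lip_free \<Rightarrow> _) S"
proof (cases "\<exists>x. x \<noteq> 0 \<and> f x = 0")
  case True
  then obtain x where x: "x \<noteq> 0" "f x = 0" by blast
  have "{0, x} \<noteq> UNIV" using inf by (metis finite.emptyI finite.insertI)
  then show ?thesis
    using x f(2) by (intro invariant_subspace_of_invariant_set[OF f, of "{0, x}"]) auto
next
  case False
  obtain r where r: "r > 0" "\<And>y. dist y (0::'a) < r \<Longrightarrow> y = 0"
    using \<open>open {0}\<close> by (auto simp: open_dist)
  define g :: "'a \<Rightarrow> 'k" where "g x = (if x = 0 then 0 else 1)" for x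
  have far: "1 \<le> 1 / r * dist x 0" "1 \<le> 1 / r * dist 0 x" if "x \<noteq> 0" for x :: 'a
    using r(2)[of x] r(1) that by (force simp: field_simps dist_commute)+
  \<comment> \<open>\<open>g\<close> jumps by 1 only between 0 and points at distance at least
    \<open>r\<close> from it.\<close>
  have "(1 / r)-lipschitz_on UNIV g"
    using r(1) far by (intro lipschitz_onI) (auto simp: g_def)
  moreover have "g 0 = 0" by (simp add: g_def)
  ultimately obtain \<phi> :: "('a, 'k) lip0" where \<phi>: "lip_fun \<phi> = g"
    by (rule lip0_of_lipschitz)
  obtain x :: 'a where x: "x \<noteq> 0" using ex_new_if_finite[OF inf, of "{0}"] by auto
  obtain y :: 'a where y: "y \<noteq> 0" "y \<noteq> x"
    using ex_new_if_finite[OF inf, of "{0, x}"] by auto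
  \<comment> \<open>As only 0 is mapped to 0, \<open>{\<phi>}\<close> is closed under composition
    with \<open>f\<close>. Its annihilator contains the difference of the deltas at two nonzero
    points.\<close>
  have "g (f z) = g z" for z
    using False f(2) by (auto simp: g_def)
  then show ?thesis
    using invariant_annihilator[OF f, of "{\<phi>}" \<phi> x "free_delta x - free_delta y"] x y
    by (auto simp: \<phi> free_delta_eq_iff) (auto simp: g_def)
qed

section \<open>Connected components and orbits\<close>

lemma connected_component_image:
  fixes f :: "'a::topological_space \<Rightarrow> 'a"
  assumes "continuous_on UNIV f" "connected_component UNIV x y"
  shows "connected_component UNIV (f x) (f y)"
proof -
  obtain T where "connected T" "x \<in> T" "y \<in> T"
    using assms(2) by (auto simp: connected_component_def)
  then show ?thesis
    using connected_continuous_image[OF continuous_on_subset[OF assms(1)], of T]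
    by (auto simp: connected_component_def)
qed

lemma invariant_subspace_of_component_with_interior:
  fixes f :: "'a::{metric_space,zero} \<Rightarrow> 'a"
  assumes inf: "infinite (UNIV :: 'a set)"
    and two: "C1 \<in> components (UNIV :: 'a set)" "C2 \<in> components (UNIV :: 'a set)" "C1 \<noteq> C2"
    and C: "C \<in> components (UNIV :: 'a set)" "interior C \<noteq> {}"
    and f: "L-lipschitz_on UNIV f" "f 0 = 0"
  shows "\<exists>S. nontrivial_invariant_subspace free_scale
    (free_map f :: ('a, 'k::real_normed_field) lip_free \<Rightarrow> _) S"
proof (rule ccontr)
  assume none: "\<not> ?thesis"
  \<comment> \<open>This dichotomy is applied below to the component of 0, to an orbit closure, to
    \<open>{0, x}\<close> and to \<open>insert 0 B\<close>.\<close>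
  have trivial: "A = {0} \<or> A = UNIV" if "closed A" "0 \<in> A" "f ` A \<subseteq> A" for A
    using none invariant_subspace_of_invariant_set[OF f that] by blast
  have not_isolated: "\<not> open {0 :: 'a}"
    using none invariant_subspace_of_isolated_basepoint[OF inf f] by blast
  let ?K = "connected_component_set (UNIV :: 'a set)"
  have cont: "continuous_on UNIV f"
    using f(1) by (rule lipschitz_on_continuous_on)
  have f_K: "f ` ?K x \<subseteq> ?K (f x)" for x
    using connected_component_image[OF cont] by auto
  have closed_K: "closed (?K x)" for x
    by (intro closed_connected_component closed_UNIV)
  have "?K 0 \<noteq> UNIV"
  proof
    assume "?K 0 = UNIV"
    then have "connected (UNIV :: 'a set)" by (metis connected_connected_component)
    then show False using two components_eq_sing_iff[of "UNIV :: 'a set"] by auto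
  qed
  then have K0: "?K 0 = {0}"
    using trivial[OF closed_K, of 0] f_K[of 0] f(2) by simp
  \<comment> \<open>Otherwise the nonempty open set \<open>interior C\<close> would be
    \<open>{0}\<close>.\<close>
  have "\<not> interior C \<subseteq> {0}"
    using C(2) not_isolated open_interior[of C] by (metis subset_singleton_iff)
  then obtain x where x: "x \<in> interior C" "x \<noteq> 0" by blast
  then have "x \<in> C" using interior_subset by blast
  then have Cx: "C = ?K x"
    using C(1) by (metis componentsE connected_component_eq)
  have "0 \<notin> C"
  proof
    assume "0 \<in> C"
    then have "?K 0 = ?K x"
      unfolding Cx by (metis connected_component_eq)
    then have "C = {0}" using Cx K0 by simp
    then show False using \<open>x \<in> C\<close> x(2) by simp
  qed
  \<comment> \<open>The orbit starts at \<open>f x\<close> rather than \<open>x\<close>, so that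
    meeting \<open>C\<close> means a return at a positive time.\<close>
  define A where "A = insert 0 (range (\<lambda>n. (f ^^ Suc n) x))"
  have "f ((f ^^ Suc n) x) \<in> A" for n
    unfolding A_def by (rule insertI2, rule range_eqI[of _ _ "Suc n"]) simp
  then have "f ` A \<subseteq> A"
    using f(2) by (auto simp: A_def)
  then have "f ` closure A \<subseteq> closure A"
    using closure_subset[of A]
    by (intro image_closure_subset[OF continuous_on_subset[OF cont]]) auto
  then consider "closure A = {0}" | "closure A = UNIV"
    using trivial[of "closure A"] closure_subset[of A] by (auto simp: A_def)
  then obtain n where n: "n > 0" "(f ^^ n) x \<in> C"
  proof cases
    case 1
    have "(f ^^ Suc 0) x \<in> A" unfolding A_def by blast
    then have "f x = 0" using 1 closure_subset[of A] by auto
    then have "{0, x} = {0} \<or> {0, x} = UNIV"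
      using f(2) by (intro trivial) auto
    then have "{0, x} = UNIV" using x(2) by blast
    then show ?thesis using inf by (metis finite.emptyI finite.insertI)
  next
    case 2
    then have "A \<inter> interior C \<noteq> {}"
      using open_Int_closure_eq_empty[OF open_interior, of C A] C(2) by auto
    then obtain a where a: "a \<in> A" "a \<in> C" using interior_subset by blast
    then have "a \<noteq> 0" using \<open>0 \<notin> C\<close> by metis
    then obtain m where "a = (f ^^ Suc m) x" using a(1) unfolding A_def by blast
    then show ?thesis using a(2) that[of "Suc m"] by simp
  qed
  \<comment> \<open>The components visited before the return time \<open>n\<close>; a finite union,
    hence closed.\<close>
  define B where "B = (\<Union>i<n. ?K ((f ^^ i) x))"
  have "closed B" by (auto simp: B_def closed_K)
  have "x \<in> B"
    using n(1) by (auto simp: B_def connected_component_refl intro!: bexI[of _ 0])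
  have "f ` B \<subseteq> B"
  proof clarify
    fix y assume "y \<in> B"
    then obtain i where i: "i < n" "y \<in> ?K ((f ^^ i) x)" by (auto simp: B_def)
    then have fy: "f y \<in> ?K ((f ^^ Suc i) x)" using f_K by auto
    show "f y \<in> B"
    proof (cases "Suc i = n")
      case True
      \<comment> \<open>At time \<open>n\<close> the orbit is back in \<open>C\<close>, the
        component with index 0, so the union closes up under \<open>f\<close>.\<close>
      have "?K ((f ^^ n) x) = ?K ((f ^^ 0) x)"
        using n(2) connected_component_eq[of "(f ^^ n) x" UNIV x] by (simp add: Cx)
      then show ?thesis using fy n(1) True unfolding B_def by blast
    next
      case False
      then show ?thesis using fy i(1) unfolding B_def by (metis UN_I Suc_lessI lessThan_iff)
    qed
  qed
  \<comment> \<open>The component of 0 is \<open>{0}\<close>, so an orbit whose component contains 0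
    has reached 0 itself. It then stays there and cannot return to \<open>C\<close>.\<close>
  have "0 \<notin> B"
  proof
    assume "0 \<in> B"
    then obtain i where i: "i < n" "0 \<in> ?K ((f ^^ i) x)" by (auto simp: B_def)
    then have "(f ^^ i) x \<in> ?K 0"
      by (auto intro: connected_component_sym)
    then have "(f ^^ i) x = 0" using K0 by simp
    moreover have "(f ^^ m) 0 = 0" for m using f(2) by (induction m) auto
    moreover have "(f ^^ n) x = (f ^^ (n - i)) ((f ^^ i) x)"
      using i(1) by (simp flip: funpow_add[THEN fun_cong, unfolded comp_apply])
    ultimately have "(f ^^ n) x = 0" by simp
    then show False using n(2) \<open>0 \<notin> C\<close> by simp
  qed
  have "insert 0 B = UNIV"
    using trivial[of "insert 0 B"] \<open>closed B\<close> \<open>f ` B \<subseteq> B\<close> f(2) \<open>x \<in> B\<close> x(2) by auto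
  \<comment> \<open>The complement of the closed set \<open>B\<close> is open, which makes 0
    isolated after all.\<close>
  then have "- B = {0}" using \<open>0 \<notin> B\<close> by auto
  then show False using \<open>closed B\<close> not_isolated by (metis open_Compl)
qed

theorem proposition3p2:
  fixes f :: "'a::{complete_space,zero} \<Rightarrow> 'a"
  assumes "infinite (UNIV :: 'a set)"
    and "\<exists>C \<in> components (UNIV :: 'a set). \<exists>D \<in> components (UNIV :: 'a set). C \<noteq> D"
    and "\<exists>C \<in> components (UNIV :: 'a set). interior C \<noteq> {}"
    and "\<exists>L. L-lipschitz_on UNIV f"
    and "f 0 = 0"
  shows "(\<exists>S. nontrivial_invariant_subspace free_scale
              (free_map f :: ('a, real) lip_free \<Rightarrow> ('a, real) lip_free) S) \<and>
         (\<exists>S. nontrivial_invariant_subspace free_scale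
              (free_map f :: ('a, complex) lip_free \<Rightarrow> ('a, complex) lip_free) S)"
  using assms by (blast intro: invariant_subspace_of_component_with_interior)

end
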